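(* Let $S$ be either a symmetric or a pseudo-symmetric numerical semigroup, and let $d\geq 2$ be an integer. If $x$ is the smallest element of $S$ such that $x\equiv f(S) \pmod d$, then $$f\left(\frac{S}{d}\right)=\frac{f(S)-x}{d}.$$
   Context: $\mathbb{N}$ denotes the set of nonnegative integers. A numerical semigroup is a submonoid $S$ of $(\mathbb{N},+)$ (so $0\in S$) such that $\mathbb{N}\setminus S$ is finite. The Frobenius number $f(S)$ is the largest integer not belonging to $S$ (so $f(\mathbb{N})=-1$). The quotient of $S$ by a positive integer $d$ is the numerical semigroup $\frac{S}{d}=\{s\in\mathbb{N}\mid ds\in S\}$. The type of $S$ is the number of integers $y\in\mathbb{Z}\setminus S$ such that $y+s\in S$ for all $s\in S\setminus\{0\}$; $S$ is symmetric if it has type one. $S$ is pseudo-symmetric if $f(S)$ is even and for every integer $n\notin S$ different from $f(S)/2$ one has $f(S)-n\in S$. *)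

theory Defs
  imports Complex_Main "HOL-Number_Theory.Cong"
begin

definition numerical_semigroup :: "nat set \<Rightarrow> bool" where
  "numerical_semigroup S \<longleftrightarrow>
     0 \<in> S \<and> (\<forall>a\<in>S. \<forall>b\<in>S. a + b \<in> S) \<and> finite (UNIV - S)"

text \<open>The gaps are taken in the integers, so that all negative integers are gaps and the
  Frobenius number of \<open>UNIV\<close> is \<open>-1\<close>.\<close>

definition frobenius_number :: "nat set \<Rightarrow> int" where
  "frobenius_number S = (GREATEST z. z \<notin> int ` S)"

definition semigroup_quotient :: "nat set \<Rightarrow> nat \<Rightarrow> nat set" where
  "semigroup_quotient S d = {s. d * s \<in> S}"

definition semigroup_type :: "nat set \<Rightarrow> nat" where
  "semigroup_type S = card {y :: int. y \<notin> int ` S \<and> (\<forall>s\<in>S - {0}. y + int s \<in> int ` S)}"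

definition symmetric_semigroup :: "nat set \<Rightarrow> bool" where
  "symmetric_semigroup S \<longleftrightarrow> semigroup_type S = 1"

definition pseudo_symmetric_semigroup :: "nat set \<Rightarrow> bool" where
  "pseudo_symmetric_semigroup S \<longleftrightarrow>
     even (frobenius_number S) \<and>
     (\<forall>n :: int. n \<notin> int ` S \<and> n \<noteq> frobenius_number S div 2
        \<longrightarrow> frobenius_number S - n \<in> int ` S)"

lemma frobenius_number_greatest:
  assumes "numerical_semigroup S"
  shows "frobenius_number S \<notin> int ` S"
    and "z \<notin> int ` S \<Longrightarrow> z \<le> frobenius_number S"
proof -
  let ?A = "insert (- 1) (int ` (UNIV - S))"
  have fin: "finite ?A"
    using assms by (simp add: numerical_semigroup_def)
  have notin: "Max ?A \<notin> int ` S"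
    using Max_in[OF fin] by auto
  have ub: "z \<le> Max ?A" if "z \<notin> int ` S" for z
  proof (cases "z \<ge> 0")
    case True
    then obtain n where "z = int n"
      using nonneg_int_cases by blast
    with that have "z \<in> ?A" by auto
    then show ?thesis using fin by (rule Max_ge[rotated])
  next
    case False
    have "- 1 \<le> Max ?A" using fin by (intro Max_ge) auto
    with False show ?thesis by linarith
  qed
  have "frobenius_number S = Max ?A"
    unfolding frobenius_number_def using notin ub by (intro Greatest_equality) auto
  then show "frobenius_number S \<notin> int ` S" "z \<notin> int ` S \<Longrightarrow> z \<le> frobenius_number S"
    using notin ub by auto
qed

lemma numerical_semigroup_quotient:
  assumes "numerical_semigroup S" and "d > 0"
  shows "numerical_semigroup (semigroup_quotient S d)"
proof -
  have "finite ((*) d -` (UNIV - S))"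
    using assms by (intro finite_vimageI) (auto simp: numerical_semigroup_def inj_on_def)
  moreover have "UNIV - semigroup_quotient S d = (*) d -` (UNIV - S)"
    by (auto simp: semigroup_quotient_def)
  ultimately show ?thesis
    using assms(1) by (auto simp: numerical_semigroup_def semigroup_quotient_def distrib_left)
qed

end

theory Submission imports Defs begin

text \<open>
  Write \<open>f\<close> for the Frobenius number of \<open>S\<close> and \<open>x = f - d * q\<close>. The integer \<open>q\<close> is a gap of the
  quotient, since \<open>d * q \<in> S\<close> would put \<open>f = x + d * q\<close> into \<open>S\<close>. It is the largest gap because of
  the duality \<open>n \<notin> S \<Longrightarrow> f - n \<in> S\<close>: for \<open>z > q\<close> the integer \<open>f - d * z\<close> is congruent to \<open>f\<close> and
  smaller than \<open>x\<close>, hence outside \<open>S\<close> by minimality of \<open>x\<close>, so its mirror image \<open>d * z\<close> lies in \<open>S\<close>.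

  In a symmetric semigroup the duality has no exceptions: every gap lies below some
  pseudo-Frobenius number with respect to the order \<open>a \<le> b \<longleftrightarrow> b - a \<in> S\<close>, and type one means that
  \<open>f\<close> is the only one (\<open>symmetric_semigroup_duality\<close>). In a pseudo-symmetric semigroup the duality
  fails only at \<open>f / 2\<close>. This point would have to be \<open>f - d * z = d * z\<close>; then \<open>d\<close> divides \<open>f\<close>, so
  \<open>x = 0\<close> and \<open>q = 2 * z\<close>, and \<open>z > q\<close> makes \<open>z\<close> negative. But \<open>f = 2 * d * z\<close> is at least \<open>-1\<close>.
\<close>

definition pseudo_frobenius :: "nat set \<Rightarrow> int \<Rightarrow> bool" where
  "pseudo_frobenius S y \<longleftrightarrow> y \<notin> int ` S \<and> (\<forall>s\<in>S - {0}. y + int s \<in> int ` S)"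

lemma frobenius_number_ge_minus_one:
  assumes "numerical_semigroup S"
  shows "-1 \<le> frobenius_number S"
  using assms by (intro frobenius_number_greatest(2)) auto

lemma pseudo_frobenius_frobenius_number:
  assumes "numerical_semigroup S"
  shows "pseudo_frobenius S (frobenius_number S)"
  unfolding pseudo_frobenius_def
proof (intro conjI ballI)
  show "frobenius_number S \<notin> int ` S"
    using assms by (rule frobenius_number_greatest(1))
next
  fix s assume "s \<in> S - {0}"
  then have "\<not> frobenius_number S + int s \<le> frobenius_number S" by simp
  then show "frobenius_number S + int s \<in> int ` S"
    using frobenius_number_greatest(2)[OF assms] by blast
qed

text \<open>
  Among the gaps of the form \<open>n + s\<close> with \<open>s \<in> S\<close>, which are bounded by the Frobenius number, the
  largest one is pseudo-Frobenius: adding a nonzero element of \<open>S\<close> to it gives a larger integer of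
  the same form.
\<close>

lemma gap_below_pseudo_frobenius:
  assumes "numerical_semigroup S" and "n \<notin> int ` S"
  obtains s where "s \<in> S" and "pseudo_frobenius S (n + int s)"
proof -
  let ?A = "{s \<in> S. n + int s \<notin> int ` S}"
  have "?A \<subseteq> {..nat (frobenius_number S - n)}"
    using frobenius_number_greatest(2)[OF assms(1)] by fastforce
  then have fin: "finite ?A"
    by (rule finite_subset) simp
  have "0 \<in> ?A"
    using assms by (simp add: numerical_semigroup_def)
  then have max_in: "Max ?A \<in> ?A"
    using fin by (intro Max_in) auto
  have "n + int (Max ?A) + int t \<in> int ` S" if t: "t \<in> S - {0}" for t
  proof (rule ccontr)
    assume "n + int (Max ?A) + int t \<notin> int ` S"
    moreover have "Max ?A + t \<in> S"
      using assms(1) max_in t by (simp add: numerical_semigroup_def)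
    ultimately have "Max ?A + t \<in> ?A"
      by (simp add: add.assoc)
    then have "Max ?A + t \<le> Max ?A"
      using fin by (rule Max_ge[rotated])
    then show False
      using t by simp
  qed
  then have "pseudo_frobenius S (n + int (Max ?A))"
    using max_in by (simp add: pseudo_frobenius_def)
  then show thesis
    using max_in that by blast
qed

lemma symmetric_semigroup_duality:
  assumes "numerical_semigroup S" and "symmetric_semigroup S" and "n \<notin> int ` S"
  shows "frobenius_number S - n \<in> int ` S"
proof -
  have "card {y. pseudo_frobenius S y} = 1"
    using assms(2)
    by (simp add: symmetric_semigroup_def semigroup_type_def pseudo_frobenius_def)
  then obtain p where "{y. pseudo_frobenius S y} = {p}"
    by (rule card_1_singletonE)
  then have unique: "y = frobenius_number S" if "pseudo_frobenius S y" for y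
    using that pseudo_frobenius_frobenius_number[OF assms(1)]
    by (metis mem_Collect_eq singletonD)
  obtain s where "s \<in> S" "pseudo_frobenius S (n + int s)"
    using gap_below_pseudo_frobenius assms(1,3) by blast
  then have "frobenius_number S - n = int s"
    using unique by fastforce
  then show ?thesis
    using \<open>s \<in> S\<close> by simp
qed

theorem corollary4p4:
  fixes S :: "nat set" and d x :: nat
  assumes "numerical_semigroup S"
    and "symmetric_semigroup S \<or> pseudo_symmetric_semigroup S"
    and "d \<ge> 2"
    and "x \<in> S"
    and "[int x = frobenius_number S] (mod int d)"
    and "\<And>y. y \<in> S \<Longrightarrow> [int y = frobenius_number S] (mod int d) \<Longrightarrow> x \<le> y"
  shows "real_of_int (frobenius_number (semigroup_quotient S d)) =
           (real_of_int (frobenius_number S) - real x) / real d"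
proof -
  let ?f = "frobenius_number S" and ?Q = "semigroup_quotient S d"
  have d_pos: "d > 0"
    using assms(3) by simp
  note quotient_greatest =
    frobenius_number_greatest[OF numerical_semigroup_quotient[OF assms(1) d_pos]]
  obtain q where f_eq: "?f = int x + int d * q"
    using assms(5) by (auto simp: cong_iff_lin)
  have q_gap: "q \<notin> int ` ?Q"
  proof
    assume "q \<in> int ` ?Q"
    then obtain s where "q = int s" "d * s \<in> S"
      by (auto simp: semigroup_quotient_def)
    then have "x + d * s \<in> S" "?f = int (x + d * s)"
      using assms(1,4) f_eq by (auto simp: numerical_semigroup_def)
    then show False
      using frobenius_number_greatest(1)[OF assms(1)] by blast
  qed
  have above_q: "z \<in> int ` ?Q" if "z > q" for z
  proof -
    have less_x: "?f - int d * z < int x"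
      using that d_pos f_eq by simp
    have gap: "?f - int d * z \<notin> int ` S"
    proof
      assume "?f - int d * z \<in> int ` S"
      then obtain y where y: "y \<in> S" "int y = ?f - int d * z"
        by auto
      then have "[int y = ?f] (mod int d)"
        by (simp add: cong_iff_dvd_diff)
      then show False
        using assms(6)[OF y(1)] y(2) less_x by simp
    qed
    have "?f - (?f - int d * z) \<in> int ` S"
    proof (cases "symmetric_semigroup S")
      case True
      then show ?thesis
        using symmetric_semigroup_duality[OF assms(1) _ gap] by blast
    next
      case False
      then have pseudo: "pseudo_symmetric_semigroup S"
        using assms(2) by blast
      have "?f - int d * z \<noteq> ?f div 2"
      proof
        assume "?f - int d * z = ?f div 2"
        then have f_twice: "?f = 2 * (int d * z)"
          using pseudo by (auto simp: pseudo_symmetric_semigroup_def)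
        then have "[int 0 = ?f] (mod int d)"
          by (simp add: cong_iff_dvd_diff)
        moreover have "0 \<in> S"
          using assms(1) by (simp add: numerical_semigroup_def)
        ultimately have "x = 0"
          using assms(6) by fastforce
        then have "int d * z < 0"
          using less_x f_twice by linarith
        then show False
          using frobenius_number_ge_minus_one[OF assms(1)] f_twice by linarith
      qed
      then show ?thesis
        using pseudo gap unfolding pseudo_symmetric_semigroup_def by blast
    qed
    then obtain s where s: "s \<in> S" "int d * z = int s"
      by auto
    then have "z \<ge> 0"
      using d_pos by (metis of_nat_0_le_iff of_nat_0_less_iff zero_le_mult_iff not_less)
    then obtain k where k: "z = int k"
      using nonneg_int_cases by blast
    then have "d * k = s"
      using s(2) by (metis of_nat_eq_iff of_nat_mult)
    then show ?thesis
      using s(1) k by (simp add: semigroup_quotient_def)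
  qed
  have "frobenius_number ?Q = q"
    using quotient_greatest(1) quotient_greatest(2)[OF q_gap] above_q
    by (meson antisym not_le)
  then show ?thesis
    using f_eq d_pos by simp
qed

end
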